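(* Let $(A,\mu,\alpha)$ be a Hom-alternative algebra over $\mathbf{k}$. Then $A$ is Hom-Jordan-admissible, i.e., its plus Hom-algebra $A^+=(A,\ast,\alpha)$, where $x\ast y=\frac12(\mu(x,y)+\mu(y,x))$, is a Hom-Jordan algebra.
   Context: $\mathbf{k}$ is a fixed field of characteristic $0$; all modules, linear maps and tensor products are over $\mathbf{k}$. A Hom-algebra is a triple $(A,\mu,\alpha)$ with $A$ a $\mathbf{k}$-module, $\mu\colon A\otimes A\to A$ bilinear (not necessarily associative or unital), and $\alpha\colon A\to A$ linear with $\alpha(\mu(x,y))=\mu(\alpha(x),\alpha(y))$ for all $x,y$. The Hom-associator is $as_A(x,y,z)=\mu(\mu(x,y),\alpha(z))-\mu(\alpha(x),\mu(y,z))$. $A$ is Hom-alternative if $as_A$ is alternating (changes by the sign of the permutation when its arguments are permuted). A Hom-Jordan algebra is a Hom-algebra $(B,\mu,\alpha)$ with $\mu$ commutative and $as_B(\mu(x,x),\alpha(y),\alpha(x))=0$ for all $x,y\in B$ (the Hom-Jordan identity), $as_B$ being the Hom-associator of $B$. *)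

theory Defs
  imports Complex_Main "HOL-Combinatorics.Permutations"
begin

(* The module A is the whole type 'a with its k-action scale; mu is given in curried form,
   so that linearity on the tensor product becomes linearity in each argument. *)
locale hom_algebra = vector_space scale
  for scale :: "'k::field_char_0 \<Rightarrow> 'a::ab_group_add \<Rightarrow> 'a" +
  fixes \<mu> :: "'a \<Rightarrow> 'a \<Rightarrow> 'a" and \<alpha> :: "'a \<Rightarrow> 'a"
  assumes linear_mult_right: "Vector_Spaces.linear scale scale (\<mu> x)"
    and linear_mult_left: "Vector_Spaces.linear scale scale (\<lambda>x. \<mu> x y)"
    and linear_twist: "Vector_Spaces.linear scale scale \<alpha>"
    and twist_mult: "\<alpha> (\<mu> x y) = \<mu> (\<alpha> x) (\<alpha> y)"

definition hom_associator ::
    "('a::ab_group_add \<Rightarrow> 'a \<Rightarrow> 'a) \<Rightarrow> ('a \<Rightarrow> 'a) \<Rightarrow> 'a \<Rightarrow> 'a \<Rightarrow> 'a \<Rightarrow> 'a"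
  where "hom_associator \<mu> \<alpha> x y z = \<mu> (\<mu> x y) (\<alpha> z) - \<mu> (\<alpha> x) (\<mu> y z)"

(* The three arguments are the values v 0, v 1, v 2 of a family v. *)
definition alternating3 ::
    "('k::field_char_0 \<Rightarrow> 'a \<Rightarrow> 'a) \<Rightarrow> ('a \<Rightarrow> 'a \<Rightarrow> 'a \<Rightarrow> 'a) \<Rightarrow> bool"
  where "alternating3 scale f \<longleftrightarrow>
    (\<forall>p (v :: nat \<Rightarrow> 'a). p permutes {..<3} \<longrightarrow>
      f (v (p 0)) (v (p 1)) (v (p 2)) = scale (of_int (sign p)) (f (v 0) (v 1) (v 2)))"

locale hom_alternative_algebra = hom_algebra scale \<mu> \<alpha>
  for scale :: "'k::field_char_0 \<Rightarrow> 'a::ab_group_add \<Rightarrow> 'a" and \<mu> \<alpha> +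
  assumes alternating_hom_associator: "alternating3 scale (hom_associator \<mu> \<alpha>)"

locale hom_jordan_algebra = hom_algebra scale \<mu> \<alpha>
  for scale :: "'k::field_char_0 \<Rightarrow> 'a::ab_group_add \<Rightarrow> 'a" and \<mu> \<alpha> +
  assumes mult_commute: "\<mu> x y = \<mu> y x"
    and hom_jordan_identity: "hom_associator \<mu> \<alpha> (\<mu> x x) (\<alpha> y) (\<alpha> x) = 0"

definition plus_mult ::
    "('k::field_char_0 \<Rightarrow> 'a::ab_group_add \<Rightarrow> 'a) \<Rightarrow> ('a \<Rightarrow> 'a \<Rightarrow> 'a) \<Rightarrow> 'a \<Rightarrow> 'a \<Rightarrow> 'a"
  where "plus_mult scale \<mu> x y = scale (1 / 2) (\<mu> x y + \<mu> y x)"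

locale hom_jordan_admissible = hom_algebra scale \<mu> \<alpha>
  for scale :: "'k::field_char_0 \<Rightarrow> 'a::ab_group_add \<Rightarrow> 'a" and \<mu> \<alpha> +
  assumes hom_jordan_plus: "hom_jordan_algebra scale (plus_mult scale \<mu>) \<alpha>"

end

theory Submission
  imports Defs
begin

text \<open>
  Write \<open>as\<close> for the Hom-associator of \<open>\<mu>\<close> and \<open>[x, y] = \<mu> x y - \<mu> y x\<close>.
  Expanding the product of \<open>A\<^sup>+\<close> and using only that \<open>as\<close> is alternating expresses
  the Hom-associator of \<open>A\<^sup>+\<close> through \<open>A\<close>:
  \<open>4 as\<^sup>+(x, y, z) = [\<alpha> y, [x, z]] - 2 as(x, y, z)\<close>  (\<open>hom_associator_plus\<close>).
  In the Hom-Jordan identity the outer arguments are \<open>\<mu> x x\<close> and \<open>\<alpha> x\<close>, and their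
  commutator is exactly \<open>as(x, x, x) = 0\<close>.

  It remains to show \<open>as(\<mu> x x, \<alpha> y, \<alpha> x) = 0\<close>.  This follows from a Hom-version of the
  Teichmueller identity, which holds in every Hom-algebra (\<open>hom_teichmueller\<close>).
  At the arguments \<open>x, x, x, y\<close> every term in it has a repeated argument except
  \<open>as(\<mu> x x, \<alpha> x, \<alpha> y)\<close> and \<open>- as(\<alpha> x, \<mu> x x, \<alpha> y)\<close>; these two are equal, so twice the
  first one vanishes.
\<close>

context hom_algebra
begin

lemmas mult_add_right = module_hom.add[OF linear_mult_right[unfolded linear_iff_module_hom]]
lemmas mult_diff_right = module_hom.diff[OF linear_mult_right[unfolded linear_iff_module_hom]]
lemmas mult_right_zero = module_hom.zero[OF linear_mult_right[unfolded linear_iff_module_hom]]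
lemmas mult_scale_right = module_hom.scale[OF linear_mult_right[unfolded linear_iff_module_hom]]
lemmas mult_add_left = module_hom.add[OF linear_mult_left[unfolded linear_iff_module_hom]]
lemmas mult_diff_left = module_hom.diff[OF linear_mult_left[unfolded linear_iff_module_hom]]
lemmas mult_left_zero = module_hom.zero[OF linear_mult_left[unfolded linear_iff_module_hom]]
lemmas mult_scale_left = module_hom.scale[OF linear_mult_left[unfolded linear_iff_module_hom]]
lemmas twist_add = module_hom.add[OF linear_twist[unfolded linear_iff_module_hom]]
lemmas twist_scale = module_hom.scale[OF linear_twist[unfolded linear_iff_module_hom]]

lemma double_eq_zero:
  fixes v :: 'a
  assumes "v + v = 0"
  shows "v = 0"
proof -
  have "scale 2 v = v + v"
    using scale_left_distrib[of 1 1 v] by simp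
  with assms show ?thesis by simp
qed

text \<open>
  Each associator contributes two of the five bracketings of \<open>w, x, y, z\<close>, twisted as needed.
  Multiplicativity of \<open>\<alpha>\<close> makes the first and third associators share the bracketing
  \<open>\<mu> (\<mu> (\<alpha> w) (\<alpha> x)) (\<mu> (\<alpha> y) (\<alpha> z))\<close>, which cancels.
\<close>
lemma hom_teichmueller:
  "hom_associator \<mu> \<alpha> (\<mu> w x) (\<alpha> y) (\<alpha> z) - hom_associator \<mu> \<alpha> (\<alpha> w) (\<mu> x y) (\<alpha> z)
     + hom_associator \<mu> \<alpha> (\<alpha> w) (\<alpha> x) (\<mu> y z)
   = \<mu> (\<alpha> (\<alpha> w)) (hom_associator \<mu> \<alpha> x y z) + \<mu> (hom_associator \<mu> \<alpha> w x y) (\<alpha> (\<alpha> z))"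
  by (simp add: hom_associator_def twist_mult mult_diff_left mult_diff_right)

lemma hom_algebra_plus: "hom_algebra scale (plus_mult scale \<mu>) \<alpha>"
proof
  fix x y b1 b2 r
  show "plus_mult scale \<mu> x (b1 + b2) = plus_mult scale \<mu> x b1 + plus_mult scale \<mu> x b2"
    by (simp add: plus_mult_def mult_add_left mult_add_right scale_right_distrib algebra_simps)
  show "plus_mult scale \<mu> x (scale r b1) = scale r (plus_mult scale \<mu> x b1)"
    by (simp add: plus_mult_def mult_scale_left mult_scale_right scale_right_distrib mult.commute)
  show "plus_mult scale \<mu> (b1 + b2) y = plus_mult scale \<mu> b1 y + plus_mult scale \<mu> b2 y"
    by (simp add: plus_mult_def mult_add_left mult_add_right scale_right_distrib algebra_simps)
  show "plus_mult scale \<mu> (scale r b1) y = scale r (plus_mult scale \<mu> b1 y)"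
    by (simp add: plus_mult_def mult_scale_left mult_scale_right scale_right_distrib mult.commute)
  show "\<alpha> (b1 + b2) = \<alpha> b1 + \<alpha> b2" by (rule twist_add)
  show "\<alpha> (scale r b1) = scale r (\<alpha> b1)" by (rule twist_scale)
  show "\<alpha> (plus_mult scale \<mu> x y) = plus_mult scale \<mu> (\<alpha> x) (\<alpha> y)"
    by (simp add: plus_mult_def twist_add twist_scale twist_mult)
qed

end

context hom_alternative_algebra
begin

lemma hom_associator_transpose:
  assumes "i < 3" "j < 3" "i \<noteq> j"
  shows "hom_associator \<mu> \<alpha> (v (transpose i j (0::nat))) (v (transpose i j 1)) (v (transpose i j 2))
    = - hom_associator \<mu> \<alpha> (v 0) (v 1) (v 2)"
proof -
  have "transpose i j permutes {..<3}"
    using assms by (intro permutes_swap_id) auto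
  then show ?thesis
    using alternating_hom_associator assms
    by (simp add: alternating3_def sign_swap_id)
qed

lemma hom_associator_swap12: "hom_associator \<mu> \<alpha> y x z = - hom_associator \<mu> \<alpha> x y z"
  using hom_associator_transpose[of 0 1 "\<lambda>n. if n = 0 then x else if n = 1 then y else z"] by simp

lemma hom_associator_swap23: "hom_associator \<mu> \<alpha> x z y = - hom_associator \<mu> \<alpha> x y z"
  using hom_associator_transpose[of 1 2 "\<lambda>n. if n = 0 then x else if n = 1 then y else z"] by simp

lemma hom_associator_repeat12: "hom_associator \<mu> \<alpha> x x z = 0"
proof (rule double_eq_zero)
  show "hom_associator \<mu> \<alpha> x x z + hom_associator \<mu> \<alpha> x x z = 0"
    using hom_associator_swap12[of x x z] by (simp only: eq_neg_iff_add_eq_0)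
qed

text \<open>
  Twice the product of \<open>A\<^sup>+\<close> is \<open>\<mu> x y + \<mu> y x\<close>, so the left-hand side has eight terms,
  each a bracketed product of \<open>x, y, z\<close> in some order.  Four of them pair up to associators
  with \<open>y\<close> in the middle.  Rebracketing the other four leaves \<open>\<alpha> y\<close> against the commutator
  of \<open>x\<close> and \<open>z\<close>, and four more associators; the six signs add up to \<open>-2\<close>.
\<close>
lemma hom_associator_plus:
  "scale 4 (hom_associator (plus_mult scale \<mu>) \<alpha> x y z)
   = \<mu> (\<alpha> y) (\<mu> x z - \<mu> z x) - \<mu> (\<mu> x z - \<mu> z x) (\<alpha> y)
     - scale 2 (hom_associator \<mu> \<alpha> x y z)"
proof -
  let ?as = "hom_associator \<mu> \<alpha>"
  have two: "scale 2 v = v + v" for v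
    using scale_left_distrib[of 1 1 v] by simp
  have "scale 4 (hom_associator (plus_mult scale \<mu>) \<alpha> x y z)
      = (\<mu> (\<mu> x y + \<mu> y x) (\<alpha> z) + \<mu> (\<alpha> z) (\<mu> x y + \<mu> y x))
        - (\<mu> (\<alpha> x) (\<mu> y z + \<mu> z y) + \<mu> (\<mu> y z + \<mu> z y) (\<alpha> x))"
    by (simp add: hom_associator_def plus_mult_def mult_scale_left mult_scale_right
        mult_add_left mult_add_right scale_right_distrib scale_right_diff_distrib)
  also have "\<dots> = \<mu> (\<alpha> y) (\<mu> x z - \<mu> z x) - \<mu> (\<mu> x z - \<mu> z x) (\<alpha> y)
      + ?as x y z - ?as z y x + ?as y x z - ?as y z x - ?as z x y + ?as x z y"
    by (simp add: hom_associator_def mult_add_left mult_add_right mult_diff_left mult_diff_right)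
  also have "\<dots> = \<mu> (\<alpha> y) (\<mu> x z - \<mu> z x) - \<mu> (\<mu> x z - \<mu> z x) (\<alpha> y) - scale 2 (?as x y z)"
  proof -
    have "?as y x z = - ?as x y z" "?as x z y = - ?as x y z"
      by (rule hom_associator_swap12 hom_associator_swap23)+
    moreover have "?as y z x = ?as x y z" "?as z x y = ?as x y z" "?as z y x = - ?as x y z"
      by (metis hom_associator_swap12 hom_associator_swap23)+
    ultimately show ?thesis by (simp add: two)
  qed
  finally show ?thesis .
qed

text \<open>
  Of the terms of the Teichmueller identity at \<open>x, x, x, y\<close>, three have a repeated argument,
  and the remaining two agree because exchanging \<open>\<mu> x x\<close> and \<open>\<alpha> x\<close> changes the sign.
\<close>
lemma hom_associator_square_twist: "hom_associator \<mu> \<alpha> (\<mu> x x) (\<alpha> x) (\<alpha> y) = 0"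
proof (rule double_eq_zero)
  show "hom_associator \<mu> \<alpha> (\<mu> x x) (\<alpha> x) (\<alpha> y) + hom_associator \<mu> \<alpha> (\<mu> x x) (\<alpha> x) (\<alpha> y) = 0"
    using hom_teichmueller[of x x x y] hom_associator_swap12[of "\<alpha> x" "\<mu> x x" "\<alpha> y"]
    by (simp add: hom_associator_repeat12 mult_left_zero mult_right_zero)
qed

lemma hom_jordan_algebra_plus: "hom_jordan_algebra scale (plus_mult scale \<mu>) \<alpha>"
proof -
  interpret plus: hom_algebra scale "plus_mult scale \<mu>" \<alpha>
    by (rule hom_algebra_plus)
  show ?thesis
  proof
    fix x y
    show "plus_mult scale \<mu> x y = plus_mult scale \<mu> y x"
      by (simp add: plus_mult_def add.commute)
    have "plus_mult scale \<mu> x x = \<mu> x x"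
      using scale_left_distrib[of "1/2" "1/2" "\<mu> x x"]
      by (simp add: plus_mult_def scale_right_distrib)
    moreover have "\<mu> (\<mu> x x) (\<alpha> x) - \<mu> (\<alpha> x) (\<mu> x x) = 0"
      using hom_associator_repeat12[of x x] by (simp only: hom_associator_def)
    moreover have "hom_associator \<mu> \<alpha> (\<mu> x x) (\<alpha> y) (\<alpha> x) = 0"
      using hom_associator_swap23[of "\<mu> x x" "\<alpha> y" "\<alpha> x"]
      by (simp add: hom_associator_square_twist)
    ultimately have "scale 4
        (hom_associator (plus_mult scale \<mu>) \<alpha> (plus_mult scale \<mu> x x) (\<alpha> y) (\<alpha> x)) = 0"
      by (simp add: hom_associator_plus mult_left_zero mult_right_zero)
    then show "hom_associator (plus_mult scale \<mu>) \<alpha> (plus_mult scale \<mu> x x) (\<alpha> y) (\<alpha> x) = 0"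
      by simp
  qed
qed

end

theorem theorem5p6:
  fixes scale :: "'k::field_char_0 \<Rightarrow> 'a::ab_group_add \<Rightarrow> 'a"
    and \<mu> :: "'a \<Rightarrow> 'a \<Rightarrow> 'a"
    and \<alpha> :: "'a \<Rightarrow> 'a"
  assumes "hom_alternative_algebra scale \<mu> \<alpha>"
  shows "hom_jordan_admissible scale \<mu> \<alpha>"
proof -
  interpret hom_alternative_algebra scale \<mu> \<alpha> by (rule assms)
  show ?thesis
    by (intro hom_jordan_admissible.intro hom_jordan_admissible_axioms.intro
        hom_algebra_axioms hom_jordan_algebra_plus)
qed

end
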